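(* Let $G$ be a finite simple connected graph on $n$ vertices with $m$ edges and matching number $\mu(G)$. For any magnetic potential $\alpha$ on $G$ we have $$\lambda_{\mu(G)+n-m}(\Delta_\alpha^G)\le 2\le\lambda_{n-\mu(G)+1}(\Delta_\alpha^G),$$ where each of the two inequalities is asserted whenever the index of the eigenvalue in it lies in $\{1,\dots,n\}$.
   Context: For a finite simple graph $G=(V,E)$ let $A$ be its set of arcs: each edge gives two oppositely oriented arcs $e,\bar e$; an arc $e$ has initial vertex $\partial_-e$ and terminal vertex $\partial_+e$; $A_v=\{e\in A : \partial_-e=v\}$ and $\deg(v)=|A_v|$. A magnetic potential on $G$ is a map $\alpha\colon A\to\mathbb{R}/2\pi\mathbb{Z}$ with $\alpha_{\bar e}=-\alpha_e$ for all $e\in A$. The discrete magnetic Laplacian is the operator $\Delta_\alpha^G$ on $\mathbb{C}^{V}$ (with its standard inner product) given by $(\Delta_\alpha^G\varphi)(v)=\deg(v)\varphi(v)-\sum_{e\in A_v}\mathrm{e}^{\mathrm{i}\alpha_e}\varphi(\partial_+e)$; it is self-adjoint and positive semidefinite. Its eigenvalues are written in ascending order, repeated according to multiplicity: $\lambda_1(\Delta_\alpha^G)\le\dots\le\lambda_n(\Delta_\alpha^G)$, $n=|V|$. The matching number $\mu(G)$ is the maximum number of edges of $G$ no two of which share a vertex. *)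

theory Defs
  imports
    Complex_Main
    "HOL-Library.Function_Algebras"
    "HOL-Library.Multiset"
    "HOL-Library.Disjoint_Sets"
    "HOL-Library.Real_Mod"
    "Graph_Theory.Graph_Theory"
begin

text \<open>
  A finite simple graph is a \<^locale>\<open>pair_graph\<close>: finitely many vertices, and a finite, symmetric,
  irreflexive set of arcs. The arc \<open>(u, v)\<close> has initial vertex \<open>u\<close>, terminal vertex \<open>v\<close> and
  opposite arc \<open>(v, u)\<close>; \<open>A\<^sub>v\<close> is \<^const>\<open>out_arcs\<close> and \<open>deg v\<close> is \<^const>\<open>out_degree\<close>.
\<close>

definition edges :: "'a pair_pre_digraph \<Rightarrow> 'a set set" where
  "edges G = {{u, v} | u v. (u, v) \<in> parcs G}"

definition matching :: "'a pair_pre_digraph \<Rightarrow> 'a set set \<Rightarrow> bool" where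
  "matching G M \<longleftrightarrow> M \<subseteq> edges G \<and> disjoint M"

definition matching_number :: "'a pair_pre_digraph \<Rightarrow> nat" where
  "matching_number G = Max (card ` {M. matching G M})"

text \<open>
  A map from the arcs to \<open>\<real>/2\<pi>\<int>\<close> is represented by an arbitrary choice of real
  representatives, so the antisymmetry holds only modulo \<open>2\<pi>\<close>. Values off the arcs are irrelevant.
\<close>

definition magnetic_potential :: "'a pair_pre_digraph \<Rightarrow> ('a \<times> 'a \<Rightarrow> real) \<Rightarrow> bool" where
  "magnetic_potential G \<alpha> \<longleftrightarrow> (\<forall>(u, v) \<in> parcs G. [\<alpha> (v, u) = - \<alpha> (u, v)] (rmod (2 * pi)))"

text \<open>\<open>\<complex>\<^sup>V\<close>, as the complex functions on the whole type that vanish outside \<open>V\<close>.\<close>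

definition cfuns :: "'a set \<Rightarrow> ('a \<Rightarrow> complex) set" where
  "cfuns V = {\<phi>. \<forall>v. v \<notin> V \<longrightarrow> \<phi> v = 0}"

definition cscale :: "complex \<Rightarrow> ('a \<Rightarrow> complex) \<Rightarrow> 'a \<Rightarrow> complex" where
  "cscale c \<phi> = (\<lambda>v. c * \<phi> v)"

lemma vector_space_cscale: "vector_space cscale"
  by unfold_locales (auto simp: cscale_def fun_eq_iff algebra_simps)

lemma subspace_cfuns: "module.subspace cscale (cfuns V)"
proof -
  interpret vector_space "cscale :: complex \<Rightarrow> ('a \<Rightarrow> complex) \<Rightarrow> _" by (rule vector_space_cscale)
  show ?thesis by (auto simp: subspace_def cfuns_def cscale_def)
qed

definition magnetic_laplacian ::
  "'a pair_pre_digraph \<Rightarrow> ('a \<times> 'a \<Rightarrow> real) \<Rightarrow> ('a \<Rightarrow> complex) \<Rightarrow> 'a \<Rightarrow> complex" where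
  "magnetic_laplacian G \<alpha> \<phi> = (\<lambda>v. if v \<in> verts G
     then of_nat (out_degree G v) * \<phi> v - (\<Sum>e \<in> out_arcs G v. cis (\<alpha> e) * \<phi> (head G e))
     else 0)"

definition eigenspace ::
  "'a set \<Rightarrow> (('a \<Rightarrow> complex) \<Rightarrow> 'a \<Rightarrow> complex) \<Rightarrow> real \<Rightarrow> ('a \<Rightarrow> complex) set" where
  "eigenspace V T t = {\<phi> \<in> cfuns V. T \<phi> = cscale (of_real t) \<phi>}"

definition multiplicity_of ::
  "'a set \<Rightarrow> (('a \<Rightarrow> complex) \<Rightarrow> 'a \<Rightarrow> complex) \<Rightarrow> real \<Rightarrow> nat" where
  "multiplicity_of V T t = vector_space.dim cscale (eigenspace V T t)"

text \<open>
  The eigenvalues of a self-adjoint operator \<open>T\<close> on \<open>\<complex>\<^sup>V\<close>, in ascending order and repeated according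
  to multiplicity. Self-adjointness is what makes it legitimate to look only at real eigenvalues and
  to take the dimension of the eigenspace as the multiplicity; for finite \<open>V\<close> the list then
  has length \<open>|V|\<close>. (An operator on \<open>\<complex>\<^sup>V\<close> has finitely many eigenvalues, so the sum below is a genuine one.)
\<close>

definition eigenvalue_list ::
  "'a set \<Rightarrow> (('a \<Rightarrow> complex) \<Rightarrow> 'a \<Rightarrow> complex) \<Rightarrow> real list" where
  "eigenvalue_list V T = sorted_list_of_multiset
     (\<Sum>t \<in> {t. \<exists>\<phi> \<in> eigenspace V T t. \<phi> \<noteq> 0}. replicate_mset (multiplicity_of V T t) t)"

text \<open>
  The \<open>k\<close>-th smallest eigenvalue of the magnetic Laplacian, counted from \<open>1\<close>; meaningful for
  \<open>k\<close> from \<open>1\<close> to the number of vertices only.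
\<close>

definition mag_eigenvalue :: "'a pair_pre_digraph \<Rightarrow> ('a \<times> 'a \<Rightarrow> real) \<Rightarrow> nat \<Rightarrow> real" where
  "mag_eigenvalue G \<alpha> k = eigenvalue_list (verts G) (magnetic_laplacian G \<alpha>) ! (k - 1)"

end

theory Submission
  imports Defs "HOL-Computational_Algebra.Fundamental_Theorem_Algebra"
begin

text \<open>
  Put \<open>D \<phi> e = \<phi> (\<partial>\<^sub>- e) - exp (i \<alpha>\<^sub>e) \<phi> (\<partial>\<^sub>+ e)\<close>, so that \<open>2 \<langle>L \<phi>, \<phi>\<rangle>\<close> is the sum of
  \<open>|D \<phi> e|\<^sup>2\<close> over all arcs, and fix a maximum matching \<open>M\<close>. If \<open>D \<phi>\<close> vanishes off \<open>M\<close>, then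
  \<open>|L \<phi>|\<^sup>2 = 2 \<langle>L \<phi>, \<phi>\<rangle>\<close>, which is impossible for a nonzero sum of eigenvectors to eigenvalues
  \<open>> 2\<close>; these \<open>m - \<mu>\<close> linear conditions therefore bound the number of eigenvalues \<open>> 2\<close>. Dually,
  if \<open>\<phi>\<close> is supported on \<open>\<Union>M\<close> and \<open>\<phi> (\<partial>\<^sub>- e) = - exp (i \<alpha>\<^sub>e) \<phi> (\<partial>\<^sub>+ e)\<close> on \<open>M\<close>, then
  \<open>\<langle>L \<phi>, \<phi>\<rangle> \<ge> 2 |\<phi>|\<^sup>2\<close>; these \<open>n - \<mu>\<close> linear conditions bound the number of eigenvalues \<open>< 2\<close>.
\<close>

section \<open>Dimension counting\<close>

text \<open>Gaussian elimination by induction on the equations. It supplies nonzero vectors three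
  times below: in sums of eigenspaces, among the iterates of \<open>T\<close>, and in orthogonal
  complements.\<close>

lemma homogeneous_system_nontrivial:
  fixes a :: "'r \<Rightarrow> 'j \<Rightarrow> 'k::field"
  assumes "finite R" "finite J" "card R < card J"
  obtains c where "\<exists>j\<in>J. c j \<noteq> 0" "\<And>r. r \<in> R \<Longrightarrow> (\<Sum>j\<in>J. c j * a r j) = 0"
proof -
  have "\<exists>c. (\<exists>j\<in>J. c j \<noteq> 0) \<and> (\<forall>r\<in>R. (\<Sum>j\<in>J. c j * a r j) = 0)"
    using assms
  proof (induction R arbitrary: J a rule: finite_induct)
    case empty
    then show ?case by (intro exI[of _ "\<lambda>_. 1"]) (auto simp: card_gt_0_iff)
  next
    case (insert r R)
    show ?case
    proof (cases "\<forall>j\<in>J. a r j = 0")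
      case True
      then show ?thesis using insert.IH[of J a] insert by auto
    next
      case False
      then obtain i where i: "i \<in> J" "a r i \<noteq> 0" by auto
      \<comment> \<open>Row \<open>r\<close> with pivot \<open>a r i\<close> clears column
        \<open>i\<close> from the other rows, leaving one equation and one unknown fewer.\<close>
      define a' where "a' = (\<lambda>s j. a s j - a r j * a s i / a r i)"
      have "card R < card (J - {i})" using insert i by auto
      then obtain c where c: "\<exists>j\<in>J - {i}. c j \<noteq> 0"
          "\<And>s. s \<in> R \<Longrightarrow> (\<Sum>j\<in>J - {i}. c j * a' s j) = 0"
        using insert.IH[of "J - {i}" a'] insert.prems by blast
      define S where "S = (\<Sum>j\<in>J - {i}. c j * a r j)"
      \<comment> \<open>The eliminated unknown is recovered by solving equation \<open>r\<close> for
        it.\<close>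
      define d where "d = c(i := - S / a r i)"
      have split: "(\<Sum>j\<in>J. d j * a s j) = - S / a r i * a s i + (\<Sum>j\<in>J - {i}. c j * a s j)" for s
        using i insert.prems by (subst sum.remove[of _ i]) (auto simp: d_def intro!: sum.cong)
      have "(\<Sum>j\<in>J. d j * a r j) = 0"
        unfolding split using i by (simp add: S_def)
      moreover have "(\<Sum>j\<in>J. d j * a s j) = 0" if "s \<in> R" for s
      proof -
        have "(\<Sum>j\<in>J - {i}. c j * a' s j) = (\<Sum>j\<in>J - {i}. c j * a s j) - S * (a s i / a r i)"
          by (simp add: a'_def S_def right_diff_distrib sum_subtractf sum_distrib_right sum_divide_distrib mult.assoc)
        then show ?thesis unfolding split using c(2)[OF that] by simp
      qed
      moreover have "\<exists>j\<in>J. d j \<noteq> 0" using c(1) by (auto simp: d_def)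
      ultimately show ?thesis by auto
    qed
  qed
  then show ?thesis using that by blast
qed

section \<open>Self-adjoint operators\<close>

interpretation fs: vector_space "cscale :: complex \<Rightarrow> ('a \<Rightarrow> complex) \<Rightarrow> 'a \<Rightarrow> complex"
  by (rule vector_space_cscale)

lemma cscale_apply: "cscale c \<phi> v = c * \<phi> v"
  by (simp add: cscale_def)

lemma sum_fun_apply: "(\<Sum>i\<in>I. f i) x = (\<Sum>i\<in>I. f i x)"
  by (induction I rule: infinite_finite_induct) auto

text \<open>\<open>cfuns V\<close> is spanned by the finitely many indicator functions of points of
  \<open>V\<close>. Finiteness makes the cardinality of a basis of an eigenspace a genuine
  count.\<close>

lemma independent_cfuns_finite:
  assumes "finite V" "fs.independent B" "B \<subseteq> cfuns V"
  shows "finite B"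
proof -
  define \<delta> :: "'a \<Rightarrow> 'a \<Rightarrow> complex" where "\<delta> = (\<lambda>v w. if w = v then 1 else 0)"
  have "\<phi> \<in> fs.span (\<delta> ` V)" if "\<phi> \<in> cfuns V" for \<phi>
  proof -
    have "\<phi> = (\<Sum>v\<in>V. cscale (\<phi> v) (\<delta> v))"
      using that assms(1) by (auto simp: fun_eq_iff sum_fun_apply cscale_def \<delta>_def cfuns_def
        sum.delta' if_distrib cong: if_cong)
    also have "\<dots> \<in> fs.span (\<delta> ` V)"
      by (intro fs.span_sum fs.span_scale fs.span_base) auto
    finally show ?thesis .
  qed
  then show ?thesis
    using fs.independent_span_bound[of "\<delta> ` V" B] assms by blast
qed

section \<open>Inner product and squared norm\<close>

definition cinner :: "'a set \<Rightarrow> ('a \<Rightarrow> complex) \<Rightarrow> ('a \<Rightarrow> complex) \<Rightarrow> complex" where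
  "cinner V \<phi> \<psi> = (\<Sum>v\<in>V. \<phi> v * cnj (\<psi> v))"

definition sqnorm :: "'a set \<Rightarrow> ('a \<Rightarrow> complex) \<Rightarrow> real" where
  "sqnorm V \<phi> = (\<Sum>v\<in>V. (cmod (\<phi> v))\<^sup>2)"

lemma cinner_self: "cinner V \<phi> \<phi> = of_real (sqnorm V \<phi>)"
  unfolding cinner_def sqnorm_def of_real_sum complex_norm_square ..

lemma cinner_cnj: "cnj (cinner V \<phi> \<psi>) = cinner V \<psi> \<phi>"
  by (simp add: cinner_def mult.commute)

lemma cinner_add_left: "cinner V (\<phi> + \<phi>') \<psi> = cinner V \<phi> \<psi> + cinner V \<phi>' \<psi>"
  by (simp add: cinner_def sum.distrib algebra_simps)

lemma cinner_scale_left: "cinner V (cscale c \<phi>) \<psi> = c * cinner V \<phi> \<psi>"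
  by (simp add: cinner_def cscale_def sum_distrib_left algebra_simps)

lemma cinner_scale_right: "cinner V \<phi> (cscale c \<psi>) = cnj c * cinner V \<phi> \<psi>"
  by (simp add: cinner_def cscale_def sum_distrib_left algebra_simps)

lemma cinner_sum_left: "cinner V (\<Sum>i\<in>I. f i) \<psi> = (\<Sum>i\<in>I. cinner V (f i) \<psi>)"
  unfolding cinner_def by (simp add: sum_fun_apply sum_distrib_right) (rule sum.swap)

lemma cinner_sum_right: "cinner V \<psi> (\<Sum>i\<in>I. f i) = (\<Sum>i\<in>I. cinner V \<psi> (f i))"
  unfolding cinner_def by (simp add: sum_fun_apply sum_distrib_left) (rule sum.swap)

lemma sqnorm_nonneg: "0 \<le> sqnorm V \<phi>"
  by (simp add: sqnorm_def sum_nonneg)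

lemma sqnorm_eq_0:
  assumes "finite V" "\<phi> \<in> cfuns V" "sqnorm V \<phi> = 0"
  shows "\<phi> = 0"
  using assms by (auto simp: sqnorm_def cfuns_def fun_eq_iff sum_nonneg_eq_0_iff)

text \<open>Linearity and symmetry of \<open>T\<close> are required on all functions on the type,
  which spares membership side conditions; \<open>cinner V\<close> sees only values on
  \<open>V\<close>.\<close>

locale self_adjoint =
  fixes V :: "'a set" and T :: "('a \<Rightarrow> complex) \<Rightarrow> 'a \<Rightarrow> complex"
  assumes finite_V: "finite V"
    and T_hom: "module_hom cscale cscale T"
    and T_cfuns: "\<phi> \<in> cfuns V \<Longrightarrow> T \<phi> \<in> cfuns V"
    and adjoint: "cinner V (T \<phi>) \<psi> = cinner V \<phi> (T \<psi>)"
begin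

section \<open>Eigenspaces, their orthogonality and their dimensions\<close>

interpretation T: module_hom cscale cscale T by (rule T_hom)

abbreviation Eig where "Eig \<equiv> eigenspace V T"

abbreviation spectrum where "spectrum \<equiv> {t. \<exists>\<phi> \<in> Eig t. \<phi> \<noteq> 0}"

lemma subspace_Eig: "fs.subspace (Eig t)"
  using subspace_cfuns[of V]
  by (auto simp: fs.subspace_def eigenspace_def T.add T.scale fs.scale_right_distrib mult.commute)

lemma Eig_cfuns: "\<phi> \<in> Eig t \<Longrightarrow> \<phi> \<in> cfuns V"
  and Eig_T: "\<phi> \<in> Eig t \<Longrightarrow> T \<phi> = cscale (of_real t) \<phi>"
  by (auto simp: eigenspace_def)

text \<open>Moving \<open>T\<close> across the product gives
  \<open>s * cinner V \<phi> \<psi> = t * cinner V \<phi> \<psi>\<close>, the eigenvalues being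
  real.\<close>

lemma Eig_orthogonal:
  assumes "\<phi> \<in> Eig s" "\<psi> \<in> Eig t" "s \<noteq> t"
  shows "cinner V \<phi> \<psi> = 0"
  using adjoint[of \<phi> \<psi>] assms by (simp add: Eig_T cinner_scale_left cinner_scale_right)

text \<open>Orthogonality kills the cross terms. The coefficient pairs (1, 1), (t, 1) and (t, t)
  then yield the squared norm of a sum of eigenvectors, its quadratic form and the squared norm of
  its image.\<close>

lemma cinner_Eig_combination:
  assumes "finite I" "\<And>t. t \<in> I \<Longrightarrow> x t \<in> Eig t"
  shows "cinner V (\<Sum>t\<in>I. cscale (of_real (c t)) (x t)) (\<Sum>t\<in>I. cscale (of_real (d t)) (x t))
    = of_real (\<Sum>t\<in>I. c t * d t * sqnorm V (x t))"
proof -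
  have "cinner V (cscale (of_real (c s)) (x s)) (\<Sum>t\<in>I. cscale (of_real (d t)) (x t))
      = of_real (c s * d s * sqnorm V (x s))" if s: "s \<in> I" for s
  proof -
    have "cinner V (cscale (of_real (c s)) (x s)) (\<Sum>t\<in>I. cscale (of_real (d t)) (x t))
        = (\<Sum>t\<in>I. if t = s then of_real (c s * d s * sqnorm V (x s)) else 0)"
      unfolding cinner_sum_right cinner_scale_left cinner_scale_right using assms s
      Eig_orthogonal[of "x s" s]
      by (intro sum.cong) (auto simp: cinner_self)
    then show ?thesis using assms s by simp
  qed
  then show ?thesis by (simp add: cinner_sum_left)
qed

lemma Eig_sum:
  assumes I: "finite I" and x: "\<And>t. t \<in> I \<Longrightarrow> x t \<in> Eig t" and \<phi>: "\<phi> = (\<Sum>t\<in>I. x t)"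
  shows "sqnorm V \<phi> = (\<Sum>t\<in>I. sqnorm V (x t))"
    and "Re (cinner V (T \<phi>) \<phi>) = (\<Sum>t\<in>I. t * sqnorm V (x t))"
    and "sqnorm V (T \<phi>) = (\<Sum>t\<in>I. t * t * sqnorm V (x t))"
proof -
  have 1: "\<phi> = (\<Sum>t\<in>I. cscale (of_real 1) (x t))" by (simp add: \<phi>)
  have 2: "T \<phi> = (\<Sum>t\<in>I. cscale (of_real t) (x t))"
    unfolding \<phi> T.sum using x by (auto simp: Eig_T intro!: sum.cong)
  show "sqnorm V \<phi> = (\<Sum>t\<in>I. sqnorm V (x t))"
    using cinner_Eig_combination[OF I x, of "\<lambda>_. 1" "\<lambda>_. 1"] 1
    by (metis (no_types, lifting) cinner_self mult_1 of_real_eq_iff sum.cong)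
  show "Re (cinner V (T \<phi>) \<phi>) = (\<Sum>t\<in>I. t * sqnorm V (x t))"
    using cinner_Eig_combination[OF I x, of "\<lambda>t. t" "\<lambda>_. 1"] unfolding 1[symmetric] 2[symmetric] by simp
  show "sqnorm V (T \<phi>) = (\<Sum>t\<in>I. t * t * sqnorm V (x t))"
    using cinner_Eig_combination[OF I x, of "\<lambda>t. t" "\<lambda>t. t"]
    unfolding 2[symmetric] cinner_self of_real_eq_iff .
qed

lemma Eig_basis:
  "\<exists>B. B \<subseteq> Eig t \<and> fs.independent B \<and> Eig t \<subseteq> fs.span B \<and> finite B \<and>
    card B = multiplicity_of V T t"
proof -
  obtain B where "B \<subseteq> Eig t" "fs.independent B" "Eig t \<subseteq> fs.span B" "card B = fs.dim (Eig t)"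
    using fs.basis_exists[of "Eig t"] by blast
  moreover from this have "finite B"
    using independent_cfuns_finite[OF finite_V, of B] Eig_cfuns by blast
  ultimately show ?thesis by (auto simp: multiplicity_of_def)
qed

text \<open>With more basis vectors than functionals, some nontrivial combination would be
  annihilated by all functionals. Injectivity is asked for componentwise, so that it also covers
  directness of the sum of eigenspaces.\<close>

lemma sum_multiplicity_le:
  fixes f :: "'r \<Rightarrow> ('a \<Rightarrow> complex) \<Rightarrow> complex"
  assumes I: "finite I" and R: "finite R"
    and f: "\<And>r. r \<in> R \<Longrightarrow> module_hom cscale (*) (f r)"
    and inj: "\<And>x t. \<lbrakk>\<And>t. t \<in> I \<Longrightarrow> x t \<in> Eig t; \<And>r. r \<in> R \<Longrightarrow> f r (\<Sum>t\<in>I. x t) = 0; t \<in> I\<rbrakk>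
      \<Longrightarrow> sqnorm V (x t) = 0"
  shows "(\<Sum>t\<in>I. multiplicity_of V T t) \<le> card R"
proof (rule ccontr)
  obtain B where B: "\<And>t. B t \<subseteq> Eig t" "\<And>t. fs.independent (B t)" "\<And>t. finite (B t)"
      "\<And>t. card (B t) = multiplicity_of V T t"
    using Eig_basis by metis
  assume "\<not> ?thesis"
  then have "card R < card (Sigma I B)" using I B by simp
  moreover have fin: "finite (Sigma I B)" using I B by auto
  ultimately obtain c where c: "\<exists>j\<in>Sigma I B. c j \<noteq> 0"
      "\<And>r. r \<in> R \<Longrightarrow> (\<Sum>j\<in>Sigma I B. c j * f r (snd j)) = 0"
    using homogeneous_system_nontrivial[OF R, of "Sigma I B" "\<lambda>r j. f r (snd j)"] by metis
  \<comment> \<open>The combination is regrouped by eigenvalue: \<open>x t\<close> is its component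
    in the eigenspace of \<open>t\<close>.\<close>
  define x where "x t = (\<Sum>b\<in>B t. cscale (c (t, b)) b)" for t
  have x: "x t \<in> Eig t" for t
    unfolding x_def using B(1) subspace_Eig
    by (intro fs.subspace_sum fs.subspace_scale) auto
  have fx: "f r (\<Sum>t\<in>I. x t) = 0" if r: "r \<in> R" for r
  proof -
    interpret f: module_hom cscale "(*)" "f r" using f[OF r] .
    show ?thesis
      using c(2)[OF r] I B by (simp add: x_def f.sum f.scale sum.Sigma case_prod_unfold)
  qed
  have "x t = 0" if "t \<in> I" for t
    using inj[of x t, OF x fx that] sqnorm_eq_0[OF finite_V Eig_cfuns[OF x]] by simp
  then have "c (t, b) = 0" if "t \<in> I" "b \<in> B t" for t b
    using fs.independentD[OF B(2)[of t] B(3)[of t] subset_refl, of "\<lambda>b. c (t, b)" b] that by (simp add: x_def)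
  with c(1) show False by auto
qed

section \<open>The spectral theorem\<close>

lemma multiplicity_pos:
  assumes "t \<in> spectrum"
  shows "1 \<le> multiplicity_of V T t"
proof -
  obtain B where B: "Eig t \<subseteq> fs.span B" "finite B" "card B = multiplicity_of V T t"
    using Eig_basis by metis
  have "B \<noteq> {}" using B(1) assms by auto
  then show ?thesis using B by (simp add: Suc_le_eq card_gt_0_iff flip: B(3))
qed

text \<open>Evaluations at the points of \<open>V\<close> detect every nonzero function in
  \<open>cfuns V\<close>, so a finite set of eigenvalues has at most \<open>card V\<close> elements.
  Sums over \<open>spectrum\<close> thereby become genuine.\<close>

lemma finite_spectrum: "finite spectrum"
proof -
  have "card I \<le> card V" if I: "I \<subseteq> spectrum" "finite I" for I
  proof -
    have "card I \<le> (\<Sum>t\<in>I. multiplicity_of V T t)"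
      using sum_mono[of I "\<lambda>_. 1" "multiplicity_of V T"] I multiplicity_pos by auto
    also have "\<dots> \<le> card V"
    proof (rule sum_multiplicity_le[OF I(2) finite_V])
      show "module_hom cscale (*) (\<lambda>\<phi>. \<phi> v)" for v :: 'a
        by unfold_locales (auto simp: cscale_def algebra_simps)
    next
      fix x t assume x: "\<And>t. t \<in> I \<Longrightarrow> x t \<in> Eig t" "\<And>v. v \<in> V \<Longrightarrow> (\<Sum>t\<in>I. x t) v = 0" "t \<in> I"
      have "sqnorm V (\<Sum>t\<in>I. x t) = 0" using x(2) by (simp add: sqnorm_def)
      then show "sqnorm V (x t) = 0"
        using Eig_sum(1)[of I x, OF I(2) x(1) refl] x(3) I(2)
        by (auto simp: sum_nonneg_eq_0_iff sqnorm_nonneg)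
    qed
    finally show ?thesis .
  qed
  then show ?thesis using finite_if_finite_subsets_card_bdd[of spectrum "card V"] by auto
qed

text \<open>Some nonzero polynomial in \<open>T\<close> annihilates \<phi>; stripping off its
  complex roots one at a time must reach an eigenvector. Invariance keeps it in \<open>W\<close>,
  and symmetry makes the eigenvalue real.\<close>

lemma eigenvector_exists:
  assumes W: "fs.subspace W" "W \<subseteq> cfuns V" "\<And>\<phi>. \<phi> \<in> W \<Longrightarrow> T \<phi> \<in> W" and \<phi>: "\<phi> \<in> W" "\<phi> \<noteq> 0"
  obtains t \<psi> where "\<psi> \<in> Eig t" "\<psi> \<in> W" "\<psi> \<noteq> 0"
proof -
  \<comment> \<open>\<open>ev p\<close> is p(T) applied to \<phi>, evaluated by Horner's
    scheme.\<close>
  define ev where "ev p = fold_coeffs (\<lambda>a \<psi>. cscale a \<phi> + T \<psi>) p 0" for p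
  have ev_0: "ev 0 = 0" by (simp add: ev_def)
  have ev_pCons: "ev (pCons a p) = cscale a \<phi> + T (ev p)" for a p
    by (cases "a = 0 \<and> p = 0") (auto simp: ev_def)
  have ev_add: "ev (p + q) = ev p + ev q" for p q
    by (induction p q rule: poly_induct2)
      (simp_all only: add_pCons add_0 ev_0 ev_pCons T.add fs.scale_left_distrib ac_simps)
  have ev_smult: "ev (smult c p) = cscale c (ev p)" for c p
    by (induction p)
      (simp_all only: smult_0_right smult_pCons ev_0 ev_pCons T.scale fs.scale_right_distrib
        fs.scale_zero_right fs.scale_scale)
  have ev_sum: "ev (\<Sum>i\<in>I. p i) = (\<Sum>i\<in>I. ev (p i))" for I :: "nat set" and p
    by (induction I rule: infinite_finite_induct) (auto simp: ev_0 ev_add)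
  have ev_monom: "ev (monom c i) = cscale c ((T ^^ i) \<phi>)" for c i
    by (induction i) (simp_all add: monom_0 monom_Suc ev_0 ev_pCons T.scale)
  have ev_W: "ev p \<in> W" for p
    using W \<phi> by (induction p)
      (auto simp: ev_0 ev_pCons fs.subspace_0 intro!: fs.subspace_add fs.subspace_scale)
  \<comment> \<open>The iterates of \<phi> under \<open>T\<close> with exponents 0 to
    \<open>card V\<close> are one too many to be independent on \<open>V\<close>.\<close>
  obtain c where c: "\<exists>i\<in>{..card V}. c i \<noteq> 0"
      "\<And>v. v \<in> V \<Longrightarrow> (\<Sum>i\<in>{..card V}. c i * (T ^^ i) \<phi> v) = 0"
    using homogeneous_system_nontrivial[of V "{..card V}" "\<lambda>v i. (T ^^ i) \<phi> v"] finite_V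
    by (metis card_atMost finite_atMost lessI)
  define p0 where "p0 = (\<Sum>i\<le>card V. monom (c i) i)"
  have "coeff p0 i = c i" if "i \<le> card V" for i
    using that by (simp add: p0_def coeff_sum)
  then have "p0 \<noteq> 0" using c(1) by auto
  moreover have "ev p0 = 0"
  proof
    fix v show "ev p0 v = 0 v"
    proof (cases "v \<in> V")
      case True
      then show ?thesis using c(2) by (simp add: p0_def ev_sum ev_monom sum_fun_apply cscale_def)
    next
      case False
      then show ?thesis using ev_W[of p0] W(2) by (auto simp: cfuns_def)
    qed
  qed
  \<comment> \<open>With p = (X - z) q, the vector \<open>ev q\<close> satisfies
    \<open>T (ev q) = cscale z (ev q)\<close>: either it is nonzero and hence an eigenvector, or
    \<open>q\<close> is an annihilating polynomial of smaller degree.\<close>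
  ultimately have "\<exists>z \<psi>. \<psi> \<in> W \<and> \<psi> \<noteq> 0 \<and> T \<psi> = cscale z \<psi>"
  proof (induction "degree p0" arbitrary: p0 rule: less_induct)
    case less
    have "\<not> constant (poly p0)"
    proof
      assume "constant (poly p0)"
      then obtain a where a: "p0 = [:a:]" by (metis constant_degree degree_eq_zeroE)
      then have "cscale a \<phi> = 0" using less.prems by (simp add: ev_pCons ev_0)
      then show False using less.prems a \<phi> by auto
    qed
    then obtain z where "poly p0 z = 0" using fundamental_theorem_of_algebra by blast
    then obtain q where q: "p0 = [:- z, 1:] * q" by (metis poly_eq_0_iff_dvd dvdE)
    then have q0: "q \<noteq> 0" using less.prems by auto
    have deg: "degree q < degree p0" unfolding q using q0 by (subst degree_mult_eq) auto
    have q0': "p0 = smult (- z) q + pCons 0 q" by (simp add: q)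
    have "ev p0 = cscale (- z) (ev q) + T (ev q)"
      unfolding q0' ev_add ev_smult ev_pCons by simp
    then have "T (ev q) = cscale z (ev q)" using less.prems by (simp add: add_eq_0_iff)
    then show ?case using less.hyps[OF deg q0] ev_W[of q] by blast
  qed
  then obtain z \<psi> where \<psi>: "\<psi> \<in> W" "\<psi> \<noteq> 0" "T \<psi> = cscale z \<psi>" by blast
  have "sqnorm V \<psi> \<noteq> 0" using sqnorm_eq_0[OF finite_V, of \<psi>] \<psi> W by auto
  moreover have "z * cinner V \<psi> \<psi> = cnj z * cinner V \<psi> \<psi>"
    using adjoint[of \<psi> \<psi>] \<psi> by (simp add: cinner_scale_left cinner_scale_right)
  ultimately have "cnj z = z" by (simp add: cinner_self)
  then have "z = of_real (Re z)" by (metis Reals_cnj_iff of_real_Re)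
  then have "\<psi> \<in> Eig (Re z)" using \<psi> W by (auto simp: eigenspace_def)
  then show ?thesis using that \<psi> by blast
qed

text \<open>If the eigenspaces were too small in total, a nonzero function would be orthogonal to
  all of them. Their orthogonal complement \<open>W\<close> is invariant under \<open>T\<close>, so
  it would contain an eigenvector, which is then orthogonal to itself.\<close>

lemma card_le_sum_multiplicity: "card V \<le> (\<Sum>t\<in>spectrum. multiplicity_of V T t)"
proof (rule ccontr)
  obtain B where B: "\<And>t. B t \<subseteq> Eig t" "\<And>t. Eig t \<subseteq> fs.span (B t)" "\<And>t. finite (B t)"
      "\<And>t. card (B t) = multiplicity_of V T t"
    using Eig_basis by metis
  assume "\<not> ?thesis"
  then have less: "card (Sigma spectrum B) < card V" using finite_spectrum B by simp
  have fin: "finite (Sigma spectrum B)" by (intro finite_SigmaI finite_spectrum B(3))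
  obtain c where c: "\<exists>v\<in>V. c v \<noteq> 0"
      "\<And>j. j \<in> Sigma spectrum B \<Longrightarrow> (\<Sum>v\<in>V. c v * cnj (snd j v)) = 0"
    using homogeneous_system_nontrivial[OF fin finite_V less, of "\<lambda>j v. cnj (snd j v)"] by blast
  define W where "W = {\<phi> \<in> cfuns V. \<forall>t. \<forall>\<psi> \<in> Eig t. cinner V \<phi> \<psi> = 0}"
  define \<phi> where "\<phi> v = (if v \<in> V then c v else 0)" for v
  have \<phi>B: "cinner V \<phi> b = 0" if "t \<in> spectrum" "b \<in> B t" for t b
    using c(2)[of "(t, b)"] that by (simp add: cinner_def \<phi>_def)
  \<comment> \<open>Orthogonality passes from bases to whole eigenspaces; a \<open>t\<close> outside
    \<open>spectrum\<close> contributes only the zero function.\<close>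
  have "cinner V \<phi> \<psi> = 0" if \<psi>: "\<psi> \<in> Eig t" for t \<psi>
  proof (cases "\<psi> = 0")
    case False
    have "\<psi> \<in> fs.span (B t)" using B(2) \<psi> by auto
    then obtain u where "\<psi> = (\<Sum>b\<in>B t. cscale (u b) b)"
      using fs.span_finite[OF B(3)[of t]] by auto
    moreover have "t \<in> spectrum" using False \<psi> by auto
    ultimately show ?thesis
      by (simp only: cinner_sum_right cinner_scale_right \<phi>B mult_zero_right sum.neutral_const
          cong: sum.cong)
  qed (simp add: cinner_def)
  then have "\<phi> \<in> W" by (simp add: W_def cfuns_def \<phi>_def)
  moreover have "\<phi> \<noteq> 0" using c(1) by (auto simp: \<phi>_def fun_eq_iff)
  moreover have "fs.subspace W"
    using subspace_cfuns[of V]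
    by (auto simp: fs.subspace_def W_def cinner_add_left cinner_scale_left) (simp add: cinner_def)
  moreover have "T \<phi> \<in> W" if "\<phi> \<in> W" for \<phi>
    using that by (auto simp: W_def T_cfuns adjoint Eig_T cinner_scale_right)
  moreover have "W \<subseteq> cfuns V" by (auto simp: W_def)
  ultimately obtain t \<psi> where "\<psi> \<in> Eig t" "\<psi> \<in> W" "\<psi> \<noteq> 0"
    using eigenvector_exists[of W \<phi>] by metis
  moreover from this have "cinner V \<psi> \<psi> = 0" by (auto simp: W_def)
  then have "sqnorm V \<psi> = 0" by (simp add: cinner_self)
  ultimately show False using sqnorm_eq_0[OF finite_V Eig_cfuns] by blast
qed

section \<open>Counting eigenvalues above or below a threshold\<close>

lemma length_filter_eigenvalue_list:
  "length (filter P (eigenvalue_list V T)) = (\<Sum>t\<in>{t \<in> spectrum. P t}. multiplicity_of V T t)"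
proof -
  have rep: "size (filter_mset P (replicate_mset k t)) = (if P t then k else 0)" for k t
    by (induction k) auto
  have "size (filter_mset P (\<Sum>t\<in>S. replicate_mset (m t) t)) = (\<Sum>t\<in>S. if P t then m t else 0)"
    if "finite S" for S :: "real set" and m
    using that by (induction S) (simp_all add: rep)
  note filter = this[OF finite_spectrum, of "multiplicity_of V T"]
  have "length (filter P l) = size (filter_mset P (mset l))" for l :: "real list"
    by (metis mset_filter size_mset)
  then have "length (filter P (eigenvalue_list V T))
      = (\<Sum>t\<in>spectrum. if P t then multiplicity_of V T t else 0)"
    by (simp only: eigenvalue_list_def mset_sorted_list_of_multiset filter)
  also have "\<dots> = (\<Sum>t\<in>{t \<in> spectrum. P t}. multiplicity_of V T t)"
    by (rule sum.inter_filter[OF finite_spectrum, symmetric])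
  finally show ?thesis .
qed

lemma length_eigenvalue_list: "card V \<le> length (eigenvalue_list V T)"
  using length_filter_eigenvalue_list[of "\<lambda>_. True"] card_le_sum_multiplicity by simp

lemma sorted_eigenvalue_list: "sorted (eigenvalue_list V T)"
  by (simp add: eigenvalue_list_def)

text \<open>For a sum \<phi> of eigenvectors \<open>x t\<close> with \<open>c < t\<close>, the
  difference \<open>sqnorm V (T \<phi>) - c * Re (cinner V (T \<phi>) \<phi>)\<close> is the sum of
  the nonnegative terms \<open>t * (t - c) * sqnorm V (x t)\<close>. On the common kernel of the
  functionals, \<open>bound\<close> makes them all vanish.\<close>

lemma count_eigenvalues_greater:
  fixes f :: "'r \<Rightarrow> ('a \<Rightarrow> complex) \<Rightarrow> complex"
  assumes "0 \<le> c" and R: "finite R"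
    and f: "\<And>r. r \<in> R \<Longrightarrow> module_hom cscale (*) (f r)"
    and bound: "\<And>\<phi>. \<lbrakk>\<phi> \<in> cfuns V; \<And>r. r \<in> R \<Longrightarrow> f r \<phi> = 0\<rbrakk>
      \<Longrightarrow> sqnorm V (T \<phi>) \<le> c * Re (cinner V (T \<phi>) \<phi>)"
  shows "length (filter (\<lambda>t. c < t) (eigenvalue_list V T)) \<le> card R"
  unfolding length_filter_eigenvalue_list
proof (rule sum_multiplicity_le[OF _ R f])
  show fin: "finite {t \<in> spectrum. c < t}" (is "finite ?I") using finite_spectrum by simp
  fix x t assume x: "\<And>t. t \<in> ?I \<Longrightarrow> x t \<in> Eig t" "\<And>r. r \<in> R \<Longrightarrow> f r (\<Sum>t\<in>?I. x t) = 0" "t \<in> ?I"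
  define \<phi> where "\<phi> = (\<Sum>t\<in>?I. x t)"
  have sums: "Re (cinner V (T \<phi>) \<phi>) = (\<Sum>t\<in>?I. t * sqnorm V (x t))"
      "sqnorm V (T \<phi>) = (\<Sum>t\<in>?I. t * t * sqnorm V (x t))"
    using Eig_sum(2,3)[OF fin _ \<phi>_def] x(1) by blast+
  have "\<phi> \<in> cfuns V"
    unfolding \<phi>_def using x(1) Eig_cfuns subspace_cfuns by (intro fs.subspace_sum) blast+
  from bound[OF this x(2)[folded \<phi>_def]] have "(\<Sum>t\<in>?I. t * (t - c) * sqnorm V (x t)) \<le> 0"
    by (simp add: sums sum_distrib_left sum_subtractf algebra_simps)
  moreover have nonneg: "0 \<le> t * (t - c) * sqnorm V (x t)" if "t \<in> ?I" for t
    using that \<open>0 \<le> c\<close> by (intro mult_nonneg_nonneg sqnorm_nonneg) auto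
  ultimately have zero: "(\<Sum>t\<in>?I. t * (t - c) * sqnorm V (x t)) = 0"
    by (intro antisym sum_nonneg) auto
  have "t * (t - c) * sqnorm V (x t) = 0"
    by (rule sum_nonneg_0[OF fin _ zero x(3)]) (rule nonneg)
  \<comment> \<open>Since \<open>0 \<le> c\<close> and \<open>c < t\<close>, the factor
    \<open>t * (t - c)\<close> is positive.\<close>
  then show "sqnorm V (x t) = 0" using x(3) \<open>0 \<le> c\<close> by auto
qed

text \<open>The Courant-Fischer argument:
  \<open>c * sqnorm V \<phi> - Re (cinner V (T \<phi>) \<phi>)\<close> is the sum of the nonnegative
  terms \<open>(c - t) * sqnorm V (x t)\<close>.\<close>

lemma count_eigenvalues_less:
  fixes f :: "'r \<Rightarrow> ('a \<Rightarrow> complex) \<Rightarrow> complex"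
  assumes R: "finite R"
    and f: "\<And>r. r \<in> R \<Longrightarrow> module_hom cscale (*) (f r)"
    and bound: "\<And>\<phi>. \<lbrakk>\<phi> \<in> cfuns V; \<And>r. r \<in> R \<Longrightarrow> f r \<phi> = 0\<rbrakk>
      \<Longrightarrow> c * sqnorm V \<phi> \<le> Re (cinner V (T \<phi>) \<phi>)"
  shows "length (filter (\<lambda>t. t < c) (eigenvalue_list V T)) \<le> card R"
  unfolding length_filter_eigenvalue_list
proof (rule sum_multiplicity_le[OF _ R f])
  show fin: "finite {t \<in> spectrum. t < c}" (is "finite ?I") using finite_spectrum by simp
  fix x t assume x: "\<And>t. t \<in> ?I \<Longrightarrow> x t \<in> Eig t" "\<And>r. r \<in> R \<Longrightarrow> f r (\<Sum>t\<in>?I. x t) = 0" "t \<in> ?I"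
  define \<phi> where "\<phi> = (\<Sum>t\<in>?I. x t)"
  have sums: "Re (cinner V (T \<phi>) \<phi>) = (\<Sum>t\<in>?I. t * sqnorm V (x t))"
      "sqnorm V \<phi> = (\<Sum>t\<in>?I. sqnorm V (x t))"
    using Eig_sum(1,2)[OF fin _ \<phi>_def] x(1) by blast+
  have "\<phi> \<in> cfuns V"
    unfolding \<phi>_def using x(1) Eig_cfuns subspace_cfuns by (intro fs.subspace_sum) blast+
  from bound[OF this x(2)[folded \<phi>_def]] have "(\<Sum>t\<in>?I. (c - t) * sqnorm V (x t)) \<le> 0"
    by (simp add: sums sum_distrib_left sum_subtractf algebra_simps)
  moreover have nonneg: "0 \<le> (c - t) * sqnorm V (x t)" if "t \<in> ?I" for t
    using that by (intro mult_nonneg_nonneg sqnorm_nonneg) auto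
  ultimately have zero: "(\<Sum>t\<in>?I. (c - t) * sqnorm V (x t)) = 0"
    by (intro antisym sum_nonneg) auto
  have "(c - t) * sqnorm V (x t) = 0"
    by (rule sum_nonneg_0[OF fin _ zero x(3)]) (rule nonneg)
  then show "sqnorm V (x t) = 0" using x(3) by auto
qed

end

section \<open>From counts to entries of a sorted list\<close>

lemma sorted_nth_le:
  fixes c :: "'b::linorder"
  assumes "sorted L" "i < length L" "length (filter (\<lambda>x. c < x) L) + i < length L"
  shows "L ! i \<le> c"
proof (rule ccontr)
  assume "\<not> ?thesis"
  moreover have "L ! i \<le> x" if "x \<in> set (drop i L)" for x
    using that assms(2) by (auto simp: in_set_conv_nth intro!: sorted_nth_mono[OF assms(1)])
  ultimately have "\<forall>x \<in> set (drop i L). c < x" by force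
  \<comment> \<open>All \<open>length L - i\<close> entries from position \<open>i\<close> on would
    exceed \<open>c\<close>, more than the count permits.\<close>
  then have "length (filter (\<lambda>x. c < x) (drop i L)) = length L - i" by simp
  moreover have "filter (\<lambda>x. c < x) L = filter (\<lambda>x. c < x) (take i L) @ filter (\<lambda>x. c < x) (drop i L)"
    by (metis append_take_drop_id filter_append)
  ultimately show False using assms(2,3) by simp
qed

lemma sorted_nth_ge:
  fixes c :: "'b::linorder"
  assumes "sorted L" "i < length L" "length (filter (\<lambda>x. x < c) L) \<le> i"
  shows "c \<le> L ! i"
proof (rule ccontr)
  assume "\<not> ?thesis"
  then have "\<forall>x \<in> set (take (Suc i) L). x < c"
    using sorted_nth_mono[OF assms(1) _ assms(2)] by (force simp: in_set_conv_nth less_Suc_eq_le)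
  \<comment> \<open>Positions 0 to \<open>i\<close> would hold \<open>Suc i\<close> entries below
    \<open>c\<close>, one more than the count permits.\<close>
  then have "length (filter (\<lambda>x. x < c) (take (Suc i) L)) = Suc i" using assms(2) by simp
  moreover have "filter (\<lambda>x. x < c) L
      = filter (\<lambda>x. x < c) (take (Suc i) L) @ filter (\<lambda>x. x < c) (drop (Suc i) L)"
    by (metis append_take_drop_id filter_append)
  ultimately show False using assms(3) by simp
qed

section \<open>The magnetic Laplacian\<close>

text \<open>This is the magnetic coboundary operator, a discrete covariant derivative along an
  arc.\<close>

definition twisted_diff :: "('a \<times> 'a \<Rightarrow> real) \<Rightarrow> ('a \<Rightarrow> complex) \<Rightarrow> 'a \<times> 'a \<Rightarrow> complex" where
  "twisted_diff \<alpha> \<phi> e = \<phi> (fst e) - cis (\<alpha> e) * \<phi> (snd e)"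

locale magnetic_graph = pair_graph G for G :: "'a pair_pre_digraph" +
  fixes \<alpha> :: "'a \<times> 'a \<Rightarrow> real"
  assumes potential: "magnetic_potential G \<alpha>"
begin

abbreviation D where "D \<equiv> twisted_diff \<alpha>"

abbreviation L where "L \<equiv> magnetic_laplacian G \<alpha>"

lemma arc_swap: "(u, v) \<in> parcs G \<Longrightarrow> (v, u) \<in> parcs G"
  using pair_sym_arcs by (auto simp: symmetric_def dest: symD)

text \<open>Reversing an arc multiplies \<open>D\<close> by a factor of modulus 1, so the vanishing
  and the modulus of \<open>D\<close> depend only on the edge. Antisymmetry modulo 2 pi suffices
  because the potential enters only through \<open>cis\<close>.\<close>

lemma D_swap:
  assumes "(u, v) \<in> parcs G"
  shows "D \<phi> (v, u) = - cnj (cis (\<alpha> (u, v))) * D \<phi> (u, v)"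
proof -
  have "cis (\<alpha> (v, u)) = cis (- \<alpha> (u, v))"
    using potential assms by (intro cis_cong) (auto simp: magnetic_potential_def)
  moreover have "cnj (cis (\<alpha> (u, v))) * (cis (\<alpha> (u, v)) * \<phi> v) = \<phi> v"
    by (simp add: cis_cnj cis_mult flip: mult.assoc)
  ultimately show ?thesis
    by (simp add: twisted_diff_def cis_cnj right_diff_distrib)
qed

text \<open>The degree term supplies one copy of \<open>\<phi> v\<close> for each outgoing
  arc.\<close>

lemma L_eq_sum_D:
  assumes "v \<in> pverts G"
  shows "L \<phi> v = (\<Sum>e\<in>{e \<in> parcs G. fst e = v}. D \<phi> e)"
  using assms by (simp add: magnetic_laplacian_def twisted_diff_def out_degree_def out_arcs_def
      sum_subtractf)

text \<open>Green's formula; the factor 2 appears because each edge is counted as two arcs.\<close>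

lemma cinner_L: "2 * cinner (pverts G) (L \<phi>) \<psi> = (\<Sum>e\<in>parcs G. D \<phi> e * cnj (D \<psi> e))"
proof -
  have "cinner (pverts G) (L \<phi>) \<psi>
      = (\<Sum>v\<in>pverts G. \<Sum>e\<in>{e \<in> parcs G. fst e = v}. D \<phi> e * cnj (\<psi> (fst e)))"
    by (auto simp: cinner_def L_eq_sum_D sum_distrib_right intro!: sum.cong)
  also have "\<dots> = (\<Sum>e\<in>parcs G. D \<phi> e * cnj (\<psi> (fst e)))"
    using pair_finite_verts pair_finite_arcs by (intro sum.group) (auto dest: in_arcsD1)
  finally have 1: "cinner (pverts G) (L \<phi>) \<psi> = (\<Sum>e\<in>parcs G. D \<phi> e * cnj (\<psi> (fst e)))" .
  \<comment> \<open>Reversing all arcs turns the same sum into a pairing with the terminal values of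
    \<psi>; adding both expressions produces \<open>D \<psi>\<close>.\<close>
  also have "\<dots> = (\<Sum>e\<in>parcs G. D \<phi> (prod.swap e) * cnj (\<psi> (fst (prod.swap e))))"
    by (rule sum.reindex_bij_witness[of _ prod.swap prod.swap]) (auto dest: arc_swap)
  also have "\<dots> = - (\<Sum>e\<in>parcs G. D \<phi> e * cnj (cis (\<alpha> e) * \<psi> (snd e)))"
    by (auto simp: D_swap simp flip: sum_negf intro!: sum.cong)
  finally show ?thesis
    using 1 by (simp add: twisted_diff_def[of _ \<psi>] sum_subtractf right_diff_distrib)
qed

lemma D_hom: "module_hom cscale (*) (\<lambda>\<phi>. D \<phi> e)"
  by unfold_locales (auto simp: twisted_diff_def cscale_def algebra_simps)

lemma L_self_adjoint: "self_adjoint (pverts G) L"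
proof
  show "finite (pverts G)" by (rule pair_finite_verts)
  have D: "D (\<phi> + \<psi>) e = D \<phi> e + D \<psi> e" "D (cscale c \<phi>) e = c * D \<phi> e" for \<phi> \<psi> c e
    by (auto simp: twisted_diff_def cscale_def algebra_simps)
  have out: "L \<phi> v = 0" if "v \<notin> pverts G" for \<phi> v
    using that by (simp add: magnetic_laplacian_def)
  show "L (\<phi> + \<psi>) = L \<phi> + L \<psi>" for \<phi> \<psi>
  proof
    fix v show "L (\<phi> + \<psi>) v = (L \<phi> + L \<psi>) v"
      by (cases "v \<in> pverts G") (simp_all add: out L_eq_sum_D D sum.distrib)
  qed
  show "L (cscale c \<phi>) = cscale c (L \<phi>)" for c \<phi>
  proof
    fix v show "L (cscale c \<phi>) v = cscale c (L \<phi>) v"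
      by (cases "v \<in> pverts G") (simp_all add: out L_eq_sum_D D sum_distrib_left cscale_apply)
  qed
  show "L \<phi> \<in> cfuns (pverts G)" for \<phi> by (simp add: cfuns_def out)
  fix \<phi> \<psi>
  \<comment> \<open>The right-hand side of \<open>cinner_L\<close> is Hermitian in its two
    arguments.\<close>
  have "cnj (2 * cinner (pverts G) (L \<psi>) \<phi>) = 2 * cinner (pverts G) (L \<phi>) \<psi>"
    unfolding cinner_L by (simp add: mult.commute)
  then show "cinner (pverts G) (L \<phi>) \<psi> = cinner (pverts G) \<phi> (L \<psi>)"
    by (simp add: cinner_cnj)
qed

text \<open>Grouping the arcs by initial vertex allows a comparison with \<open>sqnorm\<close> of
  \<open>L \<phi>\<close> and of \<phi> vertex by vertex.\<close>

lemma quadratic_form: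
  "2 * Re (cinner (pverts G) (L \<phi>) \<phi>)
    = (\<Sum>v\<in>pverts G. \<Sum>e\<in>{e \<in> parcs G. fst e = v}. (cmod (D \<phi> e))\<^sup>2)"
proof -
  have "2 * Re (cinner (pverts G) (L \<phi>) \<phi>) = Re (2 * cinner (pverts G) (L \<phi>) \<phi>)" by simp
  also have "\<dots> = (\<Sum>e\<in>parcs G. (cmod (D \<phi> e))\<^sup>2)"
    unfolding cinner_L by (simp add: complex_mult_cnj cmod_power2)
  also have "\<dots> = (\<Sum>v\<in>pverts G. \<Sum>e\<in>{e \<in> parcs G. fst e = v}. (cmod (D \<phi> e))\<^sup>2)"
    using pair_finite_verts pair_finite_arcs by (intro sum.group[symmetric]) (auto dest: in_arcsD1)
  finally show ?thesis .
qed

section \<open>Edges, orientations and matchings\<close>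

lemma finite_edges: "finite (edges G)"
proof -
  have "edges G = (\<lambda>(u, v). {u, v}) ` parcs G" by (auto simp: edges_def)
  then show ?thesis using pair_finite_arcs by simp
qed

lemma maximum_matching:
  obtains M where "matching G M" "card M = matching_number G"
proof -
  have "{M. matching G M} \<subseteq> Pow (edges G)" by (auto simp: matching_def)
  then have "finite {M. matching G M}" using finite_edges by (meson finite_Pow_iff finite_subset)
  moreover have "matching G {}" by (simp add: matching_def)
  ultimately have "matching_number G \<in> card ` {M. matching G M}"
    unfolding matching_number_def by (intro Max_in) auto
  then show ?thesis using that by auto
qed

text \<open>One arc is chosen for each edge, so that linear conditions are counted once per edge
  instead of once per arc.\<close>

definition orient :: "'a set \<Rightarrow> 'a \<times> 'a" where
  "orient E = (SOME e. e \<in> parcs G \<and> {fst e, snd e} = E)"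

lemma orient:
  assumes "E \<in> edges G"
  shows "orient E \<in> parcs G" "{fst (orient E), snd (orient E)} = E"
proof -
  have "\<exists>e. e \<in> parcs G \<and> {fst e, snd e} = E" using assms by (force simp: edges_def)
  from someI_ex[OF this] show "orient E \<in> parcs G" "{fst (orient E), snd (orient E)} = E"
    by (auto simp: orient_def)
qed

lemma orient_cases:
  assumes "(u, v) \<in> parcs G"
  shows "orient {u, v} = (u, v) \<or> orient {u, v} = (v, u)"
proof -
  have "{u, v} \<in> edges G" using assms by (auto simp: edges_def)
  from orient(2)[OF this] show ?thesis by (auto simp: doubleton_eq_iff prod_eq_iff)
qed

lemma matching_partner_unique:
  assumes "matching G M" "{u, v} \<in> M" "{u, w} \<in> M"
  shows "v = w"
proof -
  have "{u, v} = {u, w}"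
    using assms pairwiseD[of disjnt M "{u, v}" "{u, w}"] by (force simp: matching_def)
  then show ?thesis by (auto simp: doubleton_eq_iff)
qed

text \<open>An edge has two distinct endpoints as there are no loops, and distinct edges of a
  matching are disjoint.\<close>

lemma card_Union_matching:
  assumes "matching G M"
  shows "card (\<Union>M) = 2 * card M" "\<Union>M \<subseteq> pverts G" "finite M"
proof -
  have M: "M \<subseteq> edges G" "disjoint M" using assms by (auto simp: matching_def)
  have edge: "card E = 2 \<and> E \<subseteq> pverts G" if E: "E \<in> M" for E
  proof -
    obtain u v where "E = {u, v}" "(u, v) \<in> parcs G" using M(1) E by (auto simp: edges_def)
    then show ?thesis using pair_no_loops[of "(u, v)"] in_arcsD1 in_arcsD2 by auto
  qed
  show "finite M" using M(1) finite_edges finite_subset by blast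
  have "card (\<Union>M) = (\<Sum>E\<in>M. card E)"
    using M(2) edge finite_subset[OF _ pair_finite_verts] by (intro card_Union_disjoint) auto
  then show "card (\<Union>M) = 2 * card M" using edge by simp
  show "\<Union>M \<subseteq> pverts G" using edge by blast
qed

text \<open>If \<open>D \<phi>\<close> is supported on the matching, each vertex sees at most one nonzero term, so
  \<open>|L \<phi>|\<^sup>2\<close> equals the sum of \<open>|D \<phi>|\<^sup>2\<close> over all arcs, which is twice the quadratic form.\<close>

lemma sqnorm_L_matching:
  assumes M: "matching G M" and D0: "\<And>E. E \<in> edges G - M \<Longrightarrow> D \<phi> (orient E) = 0"
  shows "sqnorm (pverts G) (L \<phi>) = 2 * Re (cinner (pverts G) (L \<phi>) \<phi>)"
proof -
  \<comment> \<open>A zero of \<open>D\<close> on the chosen arc of an edge carries over to the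
    opposite arc.\<close>
  have D0': "D \<phi> (u, v) = 0" if "(u, v) \<in> parcs G" "{u, v} \<notin> M" for u v
  proof -
    have "{u, v} \<in> edges G - M" using that by (auto simp: edges_def)
    from D0[OF this] show ?thesis
      using orient_cases[OF that(1)] D_swap[OF that(1), of \<phi>] by auto
  qed
  have "(cmod (L \<phi> u))\<^sup>2 = (\<Sum>e\<in>{e \<in> parcs G. fst e = u}. (cmod (D \<phi> e))\<^sup>2)" if u: "u \<in> pverts G" for u
  proof (cases "\<exists>v. (u, v) \<in> parcs G \<and> {u, v} \<in> M")
    case True
    then obtain v where v: "(u, v) \<in> parcs G" "{u, v} \<in> M" by auto
    have zero: "D \<phi> e = 0" if "e \<in> {e \<in> parcs G. fst e = u} - {(u, v)}" for e
      using that D0'[of u "snd e"] matching_partner_unique[OF M v(2), of "snd e"]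
      by (cases e) auto
    \<comment> \<open>Only the arc to the partner of \<open>u\<close> survives; a general
      \<open>g\<close> covers both the sum of \<open>D\<close> and the sum of its squared
      moduli.\<close>
    have sum: "(\<Sum>e\<in>{e \<in> parcs G. fst e = u}. g (D \<phi> e)) = g (D \<phi> (u, v))"
      if "g 0 = 0" for g :: "complex \<Rightarrow> 'b::comm_monoid_add"
      using v zero that pair_finite_arcs by (subst sum.remove[of _ "(u, v)"]) auto
    show ?thesis using u sum[of "\<lambda>z. z"] sum[of "\<lambda>z. (cmod z)\<^sup>2"] by (simp add: L_eq_sum_D)
  next
    case False
    then have "D \<phi> e = 0" if "e \<in> {e \<in> parcs G. fst e = u}" for e
      using that D0'[of u "snd e"] by (cases e) auto
    then show ?thesis using u by (simp add: L_eq_sum_D)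
  qed
  then show ?thesis by (simp add: quadratic_form sqnorm_def)
qed

text \<open>Here the two terms of \<open>D \<phi>\<close> agree on each matching edge, so \<open>|D \<phi>|\<^sup>2 = 4 |\<phi>|\<^sup>2\<close> there.\<close>

lemma sqnorm_le_quadratic_form_matching:
  assumes M: "matching G M"
    and anti: "\<And>E. E \<in> M \<Longrightarrow> \<phi> (fst (orient E)) + cis (\<alpha> (orient E)) * \<phi> (snd (orient E)) = 0"
    and supp: "\<And>v. v \<in> pverts G - \<Union>M \<Longrightarrow> \<phi> v = 0"
  shows "2 * sqnorm (pverts G) \<phi> \<le> Re (cinner (pverts G) (L \<phi>) \<phi>)"
proof -
  have D2: "cmod (D \<phi> (u, v)) = 2 * cmod (\<phi> u)" if uv: "(u, v) \<in> parcs G" "{u, v} \<in> M" for u v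
  proof (cases "orient {u, v} = (u, v)")
    case True
    then have "cis (\<alpha> (u, v)) * \<phi> v = - \<phi> u"
      using anti[OF uv(2)] by (simp add: add_eq_0_iff)
    then show ?thesis by (simp add: twisted_diff_def norm_mult flip: mult_2)
  next
    case False
    then have "orient {u, v} = (v, u)" using orient_cases[OF uv(1)] by auto
    then have "\<phi> v = - (cis (\<alpha> (v, u)) * \<phi> u)"
      using anti[OF uv(2)] by (simp add: eq_neg_iff_add_eq_0)
    then have "cmod (D \<phi> (v, u)) = 2 * cmod (\<phi> u)"
      by (simp add: twisted_diff_def norm_mult flip: mult_2 minus_add_distrib)
    then show ?thesis using D_swap[OF uv(1), of \<phi>] by (simp add: norm_mult)
  qed
  \<comment> \<open>A single matching arc out of \<open>u\<close> already contributes the left-hand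
    side, and \<phi> vanishes at uncovered vertices. Summation over \<open>u\<close> bounds twice
    the quadratic form, whence the constant 2.\<close>
  have "4 * (cmod (\<phi> u))\<^sup>2 \<le> (\<Sum>e\<in>{e \<in> parcs G. fst e = u}. (cmod (D \<phi> e))\<^sup>2)" if "u \<in> pverts G" for u
  proof (cases "u \<in> \<Union>M")
    case True
    then obtain v where v: "(u, v) \<in> parcs G" "{u, v} \<in> M"
      using M arc_swap by (fastforce simp: matching_def edges_def insert_commute)
    have "4 * (cmod (\<phi> u))\<^sup>2 = (cmod (D \<phi> (u, v)))\<^sup>2" using D2[OF v] by (simp add: power_mult_distrib)
    also have "\<dots> \<le> (\<Sum>e\<in>{e \<in> parcs G. fst e = u}. (cmod (D \<phi> e))\<^sup>2)"
      using v pair_finite_arcs by (intro member_le_sum) auto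
    finally show ?thesis .
  next
    case False
    then show ?thesis using supp that by (simp add: sum_nonneg)
  qed
  then have "(\<Sum>u\<in>pverts G. 4 * (cmod (\<phi> u))\<^sup>2) \<le> 2 * Re (cinner (pverts G) (L \<phi>) \<phi>)"
    unfolding quadratic_form by (intro sum_mono)
  then show ?thesis by (simp add: sqnorm_def flip: sum_distrib_left)
qed

section \<open>Eigenvalues of the magnetic Laplacian on either side of 2\<close>

sublocale L: self_adjoint "pverts G" L by (rule L_self_adjoint)

text \<open>One functional for each edge outside a maximum matching, with the threshold 2 supplied
  by \<open>sqnorm_L_matching\<close>. The additive form avoids truncated subtraction.\<close>

lemma count_eigenvalues_greater_2:
  "length (filter (\<lambda>t. 2 < t) (eigenvalue_list (pverts G) L)) + matching_number G \<le> card (edges G)"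
proof -
  obtain M where M: "matching G M" "card M = matching_number G" by (rule maximum_matching)
  have "length (filter (\<lambda>t. 2 < t) (eigenvalue_list (pverts G) L)) \<le> card (edges G - M)"
    using finite_edges D_hom sqnorm_L_matching[OF M(1)]
    by (intro L.count_eigenvalues_greater[where f = "\<lambda>E \<phi>. D \<phi> (orient E)"]) auto
  moreover have "M \<subseteq> edges G" using M(1) by (simp add: matching_def)
  ultimately show ?thesis
    using M(2) card_Union_matching(3)[OF M(1)] card_mono[OF finite_edges, of M]
    by (simp add: card_Diff_subset)
qed

text \<open>Each of the \<mu> matching edges imposes one condition and each of the n - 2\<mu>
  uncovered vertices another, n - \<mu> in all.\<close>

lemma count_eigenvalues_less_2:
  "length (filter (\<lambda>t. t < 2) (eigenvalue_list (pverts G) L)) + matching_number G \<le> card (pverts G)"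
proof -
  obtain M where M: "matching G M" "card M = matching_number G" by (rule maximum_matching)
  note U = card_Union_matching[OF M(1)]
  \<comment> \<open>\<open>Inl\<close> indexes the antisymmetry conditions on matching edges,
    \<open>Inr\<close> the vanishing at uncovered vertices.\<close>
  define f where "f = case_sum (\<lambda>E \<phi>. \<phi> (fst (orient E)) + cis (\<alpha> (orient E)) * \<phi> (snd (orient E)))
    (\<lambda>v \<phi>. \<phi> v)"
  have "length (filter (\<lambda>t. t < 2) (eigenvalue_list (pverts G) L)) \<le> card (M <+> (pverts G - \<Union>M))"
  proof (rule L.count_eigenvalues_less[where f = f])
    show "finite (M <+> (pverts G - \<Union>M))" using U pair_finite_verts by simp
    show "module_hom cscale (*) (f r)" for r
      by (cases r; unfold_locales) (auto simp: f_def cscale_def algebra_simps)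
    fix \<phi> assume f: "\<And>r. r \<in> M <+> (pverts G - \<Union>M) \<Longrightarrow> f r \<phi> = 0"
    show "2 * sqnorm (pverts G) \<phi> \<le> Re (cinner (pverts G) (L \<phi>) \<phi>)"
      using f[OF InlI] f[OF InrI]
      by (intro sqnorm_le_quadratic_form_matching[OF M(1)]) (auto simp: f_def)
  qed
  moreover have "card (M <+> (pverts G - \<Union>M)) = card M + (card (pverts G) - 2 * card M)"
    using U pair_finite_verts by (simp add: card_Plus card_Diff_subset finite_subset)
  moreover have "2 * card M \<le> card (pverts G)"
    using U card_mono[OF pair_finite_verts U(2)] by simp
  ultimately show ?thesis using M(2) by simp
qed

end

theorem corollary3p5:
  fixes G :: "'a pair_pre_digraph" and \<alpha> :: "'a \<times> 'a \<Rightarrow> real" and n m :: nat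
  assumes "pair_graph G"
    and "Digraph_Component.connected G"
    and "n = card (verts G)"
    and "m = card (edges G)"
    and "magnetic_potential G \<alpha>"
  shows "(\<forall>k \<in> {1..n}. int k = int (matching_number G) + int n - int m \<longrightarrow>
            mag_eigenvalue G \<alpha> k \<le> 2) \<and>
         (\<forall>k \<in> {1..n}. int k = int n - int (matching_number G) + 1 \<longrightarrow>
            2 \<le> mag_eigenvalue G \<alpha> k)"
proof -
  interpret pair_graph G by fact
  interpret magnetic_graph G \<alpha> by unfold_locales fact
  have n: "n \<le> length (eigenvalue_list (pverts G) L)"
    using L.length_eigenvalue_list assms(3) by simp
  \<comment> \<open>List positions start at 0. At least n - (k - 1) = m - \<mu> + 1 entries stand
    from position k - 1 on, while at most m - \<mu> entries exceed 2.\<close>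
  have "mag_eigenvalue G \<alpha> k \<le> 2"
    if "k \<in> {1..n}" "int k = int (matching_number G) + int n - int m" for k
    unfolding mag_eigenvalue_def with_proj_simps
    using that n count_eigenvalues_greater_2 assms(4)
    by (intro sorted_nth_le L.sorted_eigenvalue_list) auto
  \<comment> \<open>Here k - 1 = n - \<mu>, which is exactly the bound on the number of entries
    below 2.\<close>
  moreover have "2 \<le> mag_eigenvalue G \<alpha> k"
    if "k \<in> {1..n}" "int k = int n - int (matching_number G) + 1" for k
    unfolding mag_eigenvalue_def with_proj_simps
    using that n count_eigenvalues_less_2 assms(3)
    by (intro sorted_nth_ge L.sorted_eigenvalue_list) auto
  ultimately show ?thesis by blast
qed

end
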